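(* Let $N=\{1,\ldots,n\}$ and let $G:[-1,1]^n\to[-1,1]$ be an aggregation function. Then $G$ is idempotent, bipolar comonotone maxitive, bipolar stable with respect to the sign and bipolar stable with respect to the minimum if and only if there exists a bi-capacity $\mu_b$ on $N$ such that, for all $x\in[-1,1]^n$, $$G(x)=Su_b(x,\mu_b),$$ where $Su_b(x,\mu_b)$ is the bipolar Sugeno integral of $x$ with respect to $\mu_b$.
   Context: Aggregation function: $G:[-1,1]^n\to[-1,1]$ with $G(-1,\ldots,-1)=-1$, $G(1,\ldots,1)=1$, and $G(x)\ge G(y)$ whenever $x_i\ge y_i$ for all $i\in N$. Idempotent: $G(a,\ldots,a)=a$ for all $a\in[-1,1]$. $\mathcal Q=\{(A,B)\in 2^N\times 2^N: A\cap B=\emptyset\}$. Write $(A,B)\precsim(C,D)$ if $A\subseteq C$ and $B\supseteq D$; write $(A,B)\subseteq(C,D)$ if $A\subseteq C$ and $B\subseteq D$. For $(A,B)\in\mathcal Q$, $\mathbf 1_{(A,B)}\in\{-1,0,1\}^n$ is the vector with $i$-th component $1$ if $i\in A$, $-1$ if $i\in B$, and $0$ otherwise. Bi-capacity on $N$: a function $\mu_b:\mathcal Q\to[-1,1]$ with $\mu_b(\emptyset,\emptyset)=0$, $\mu_b(N,\emptyset)=1$, $\mu_b(\emptyset,N)=-1$, and $\mu_b(A,B)\le\mu_b(C,D)$ whenever $(A,B)\precsim(C,D)$. Bipolar maximum: for $X=\{x_1,\ldots,x_m\}\subseteq\mathbb R$, if there is $x_k\in X$ with $|x_k|>|x_j|$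 for all $j$ with $x_j\ne x_k$, then $\bigvee^b X=x_k$; otherwise $\bigvee^b X=0$. For vectors, $\bigvee^b$ is taken componentwise. Bipolar comonotone maxitive: for every $k\ge1$, with $K=\{1,\ldots,k\}$, all levels $0<l_1<l_2<\cdots<l_k\le1$ and all $(A_1,B_1),\ldots,(A_k,B_k)\in\mathcal Q$ with $(A_{i+1},B_{i+1})\subseteq(A_i,B_i)$ for $i=1,\ldots,k-1$, $$G\Big(\bigvee_{i\in K}{}^{b}\; l_i\mathbf 1_{(A_i,B_i)}\Big)=\bigvee_{i\in K}{}^{b}\; G\big(l_i\mathbf 1_{(A_i,B_i)}\big).$$ Bipolar stable with respect to the sign: for all $r,s\in\,]0,1]$ and all $(A,B)\in\mathcal Q$, either $G(r\mathbf 1_{(A,B)})\,G(s\mathbf 1_{(A,B)})>0$ or $G(r\mathbf 1_{(A,B)})=G(s\mathbf 1_{(A,B)})=0$. Bipolar stable with respect to the minimum: for all $r,s\in\,]0,1]$ with $r>s$ and all $(A,B)\in\mathcal Q$, $|G(r\mathbf 1_{(A,B)})|\ge|G(s\mathbf 1_{(A,B)})|$, and moreover if $|G(r\mathbf 1_{(A,B)})|>|G(s\mathbf 1_{(A,B)})|$ then $|G(s\mathbf 1_{(A,B)})|=s$. Bipolar Sugeno integral of $x\in[-1,1]^n$ with respect to $\mu_b$: writing $m_i=\mu_b(\{j\in N:x_j\ge|x_i|\},\{j\in N:x_j\le-|x_i|\})$ for $i\in N$ (with the convention that when $x_i=0$ the inequality $x_j\le-|x_i|$ is read as $x_j<0$,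 so that the pair lies in $\mathcal Q$), $$Su_b(x,\mu_b)=\bigvee_{i\in N}{}^{b}\;\big\{\operatorname{sign}(m_i)\cdot\min\{|m_i|,|x_i|\}\big\},$$ with $\operatorname{sign}(0)=0$. *)

theory Defs
  imports "HOL-Analysis.Analysis"
begin

text \<open>
  The index set \<open>N\<close> is the universe of an arbitrary finite type \<open>'n\<close> (so \<open>n\<close> is \<open>CARD('n)\<close>),
  and functions on \<open>[-1,1]\<^sup>n\<close> are total functions on \<open>real ^ 'n\<close> of which only the values on
  the cube are ever constrained.
\<close>

definition cube :: "(real ^ 'n) set"
  where "cube = {x. \<forall>i. x $ i \<in> {-1..1}}"

definition aggregation_function :: "(real ^ 'n \<Rightarrow> real) \<Rightarrow> bool"
  where "aggregation_function G \<longleftrightarrow>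
    G \<in> cube \<rightarrow> {-1..1} \<and> G (vec (-1)) = -1 \<and> G (vec 1) = 1 \<and>
    (\<forall>x\<in>cube. \<forall>y\<in>cube. (\<forall>i. x $ i \<ge> y $ i) \<longrightarrow> G x \<ge> G y)"

definition idempotent :: "(real ^ 'n \<Rightarrow> real) \<Rightarrow> bool"
  where "idempotent G \<longleftrightarrow> (\<forall>a\<in>{-1..1}. G (vec a) = a)"

definition Q :: "('n set \<times> 'n set) set"
  where "Q = {(A, B). A \<inter> B = {}}"

definition pair_prec :: "'n set \<times> 'n set \<Rightarrow> 'n set \<times> 'n set \<Rightarrow> bool"
  where "pair_prec P R \<longleftrightarrow> fst P \<subseteq> fst R \<and> snd P \<supseteq> snd R"

definition pair_subset :: "'n set \<times> 'n set \<Rightarrow> 'n set \<times> 'n set \<Rightarrow> bool"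
  where "pair_subset P R \<longleftrightarrow> fst P \<subseteq> fst R \<and> snd P \<subseteq> snd R"

definition bi_indicator :: "'n set \<times> 'n set \<Rightarrow> real ^ 'n"
  where "bi_indicator P = (\<chi> i. if i \<in> fst P then 1 else if i \<in> snd P then -1 else 0)"

text \<open>Values of a bi-capacity outside \<open>Q\<close> are irrelevant.\<close>

definition bi_capacity :: "('n set \<times> 'n set \<Rightarrow> real) \<Rightarrow> bool"
  where "bi_capacity \<mu> \<longleftrightarrow>
    \<mu> \<in> Q \<rightarrow> {-1..1} \<and> \<mu> ({}, {}) = 0 \<and> \<mu> (UNIV, {}) = 1 \<and> \<mu> ({}, UNIV) = -1 \<and>
    (\<forall>P\<in>Q. \<forall>R\<in>Q. pair_prec P R \<longrightarrow> \<mu> P \<le> \<mu> R)"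

text \<open>
  The bipolar maximum is an operation on sets: repeated values count once, so only
  \<open>a\<close> and \<open>-a\<close> both being of maximal absolute value makes it cancel to \<open>0\<close>.
\<close>

definition abs_dominant :: "real set \<Rightarrow> real \<Rightarrow> bool"
  where "abs_dominant X x \<longleftrightarrow> x \<in> X \<and> (\<forall>y\<in>X. y \<noteq> x \<longrightarrow> \<bar>x\<bar> > \<bar>y\<bar>)"

lemma abs_dominant_unique: "abs_dominant X x \<Longrightarrow> abs_dominant X y \<Longrightarrow> x = y"
  unfolding abs_dominant_def by (metis less_asym)

definition bipolar_max :: "real set \<Rightarrow> real"
  where "bipolar_max X = (if \<exists>x. abs_dominant X x then THE x. abs_dominant X x else 0)"

definition bipolar_max_vec :: "(real ^ 'n) set \<Rightarrow> real ^ 'n"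
  where "bipolar_max_vec V = (\<chi> j. bipolar_max ((\<lambda>v. v $ j) ` V))"

definition bipolar_comonotone_maxitive :: "(real ^ 'n \<Rightarrow> real) \<Rightarrow> bool"
  where "bipolar_comonotone_maxitive G \<longleftrightarrow>
    (\<forall>(k::nat) \<ge> 1. \<forall>(l :: nat \<Rightarrow> real) (P :: nat \<Rightarrow> 'n set \<times> 'n set).
      (\<forall>i\<in>{1..k}. 0 < l i \<and> l i \<le> 1) \<and> strict_mono_on {1..k} l \<and>
      (\<forall>i\<in>{1..k}. P i \<in> Q) \<and> (\<forall>i\<in>{1..<k}. pair_subset (P (i + 1)) (P i)) \<longrightarrow>
      G (bipolar_max_vec ((\<lambda>i. l i *\<^sub>R bi_indicator (P i)) ` {1..k})) =
        bipolar_max ((\<lambda>i. G (l i *\<^sub>R bi_indicator (P i))) ` {1..k}))"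

definition bipolar_stable_sign :: "(real ^ 'n \<Rightarrow> real) \<Rightarrow> bool"
  where "bipolar_stable_sign G \<longleftrightarrow>
    (\<forall>r\<in>{0<..1}. \<forall>s\<in>{0<..1}. \<forall>P\<in>Q.
      G (r *\<^sub>R bi_indicator P) * G (s *\<^sub>R bi_indicator P) > 0 \<or>
      (G (r *\<^sub>R bi_indicator P) = 0 \<and> G (s *\<^sub>R bi_indicator P) = 0))"

definition bipolar_stable_min :: "(real ^ 'n \<Rightarrow> real) \<Rightarrow> bool"
  where "bipolar_stable_min G \<longleftrightarrow>
    (\<forall>r\<in>{0<..1}. \<forall>s\<in>{0<..1}. \<forall>P\<in>Q. r > s \<longrightarrow>
      \<bar>G (r *\<^sub>R bi_indicator P)\<bar> \<ge> \<bar>G (s *\<^sub>R bi_indicator P)\<bar> \<and>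
      (\<bar>G (r *\<^sub>R bi_indicator P)\<bar> > \<bar>G (s *\<^sub>R bi_indicator P)\<bar> \<longrightarrow>
        \<bar>G (s *\<^sub>R bi_indicator P)\<bar> = s))"

text \<open>For \<open>x $ i = 0\<close> the second component uses a strict inequality, so that the pair lies in \<open>Q\<close>.\<close>

definition level_pair :: "real ^ 'n \<Rightarrow> 'n \<Rightarrow> 'n set \<times> 'n set"
  where "level_pair x i =
    ({j. x $ j \<ge> \<bar>x $ i\<bar>}, {j. if x $ i = 0 then x $ j < 0 else x $ j \<le> - \<bar>x $ i\<bar>})"

definition bipolar_sugeno :: "real ^ 'n \<Rightarrow> ('n set \<times> 'n set \<Rightarrow> real) \<Rightarrow> real"
  where "bipolar_sugeno x \<mu> =
    bipolar_max (range (\<lambda>i. sgn (\<mu> (level_pair x i)) * min \<bar>\<mu> (level_pair x i)\<bar> \<bar>x $ i\<bar>))"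

end

theory Submission
  imports Defs
begin

text \<open>
  Every nonzero \<open>x\<close> in the cube is the bipolar maximum of \<open>l\<^sub>i \<one>\<^bsub>P\<^sub>i\<^esub>\<close>, where the \<open>l\<^sub>i\<close> are the
  nonzero values of \<open>\<bar>x\<^sub>j\<bar>\<close> and \<open>P\<^sub>i = ({x \<ge> l\<^sub>i}, {x \<le> -l\<^sub>i})\<close>. On any such nested family the
  bipolar Sugeno integral is the bipolar maximum of its values \<open>sgn (\<mu> P\<^sub>i) min(\<bar>\<mu> P\<^sub>i\<bar>, l\<^sub>i)\<close>
  on the pieces: levels not attained by \<open>x\<close> are dominated, with the same sign, by attained ones.
  So comonotone maxitivity reduces the equivalence to \<open>G (l \<one>\<^bsub>P\<^esub>) = sgn (\<mu> P) min(\<bar>\<mu> P\<bar>, l)\<close>, and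
  with \<open>\<mu> P = G (\<one>\<^bsub>P\<^esub>)\<close> this is what the two stability properties say once monotonicity and
  idempotency give \<open>\<bar>G (l \<one>\<^bsub>P\<^esub>)\<bar> \<le> l\<close>.
\<close>

section \<open>The bipolar maximum and its invariance under domination\<close>

lemma bipolar_max_eq:
  assumes "abs_dominant X v"
  shows "bipolar_max X = v"
proof -
  have "(THE x. abs_dominant X x) = v"
    using assms abs_dominant_unique by blast
  then show ?thesis
    using assms unfolding bipolar_max_def by auto
qed

lemma bipolar_max_singleton [simp]: "bipolar_max {v} = v"
  by (rule bipolar_max_eq) (simp add: abs_dominant_def)

lemma bipolar_max_nonzeroD:
  assumes "bipolar_max X \<noteq> 0"
  shows "abs_dominant X (bipolar_max X)"
  using assms bipolar_max_eq by (metis bipolar_max_def)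

text \<open>Mutual domination is the equivalence used to compare bipolar maxima. Zeros need no
  counterpart, since adding 0 to a set never changes its bipolar maximum.\<close>

definition sgn_dominated :: "real set \<Rightarrow> real set \<Rightarrow> bool"
  where "sgn_dominated X Y \<longleftrightarrow> (\<forall>x\<in>X. x \<noteq> 0 \<longrightarrow> (\<exists>y\<in>Y. sgn x = sgn y \<and> \<bar>x\<bar> \<le> \<bar>y\<bar>))"

lemma abs_dominant_transfer:
  assumes XY: "sgn_dominated X Y" and YX: "sgn_dominated Y X"
    and v: "abs_dominant X v" "v \<noteq> 0"
  shows "abs_dominant Y v"
proof -
  have eq: "a = b" if "sgn a = sgn b" "\<bar>a\<bar> = \<bar>b\<bar>" for a b :: real
    using that by (metis abs_mult_sgn)
  have le: "\<bar>x\<bar> \<le> \<bar>v\<bar>" if "x \<in> X" for x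
    using v that unfolding abs_dominant_def by (metis less_imp_le order_refl)
  have max: "x = v" if "x \<in> X" "\<bar>v\<bar> \<le> \<bar>x\<bar>" for x
    using v that unfolding abs_dominant_def by (metis not_less)
  \<comment> \<open>Domination sends \<open>y\<close> to an element of \<open>X\<close> of the same
    sign and at least its size. That element can only be \<open>v\<close>, so \<open>y\<close> has
    the sign and the size of \<open>v\<close>.\<close>
  have top: "y = v" if y: "y \<in> Y" "\<bar>v\<bar> \<le> \<bar>y\<bar>" for y
  proof -
    have "y \<noteq> 0" using y v by auto
    then obtain x where x: "x \<in> X" "sgn y = sgn x" "\<bar>y\<bar> \<le> \<bar>x\<bar>"
      using YX y unfolding sgn_dominated_def by blast
    then have "x = v" using max y by simp
    then show ?thesis using eq[of y x] x y by linarith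
  qed
  have "v \<in> X" using v by (simp add: abs_dominant_def)
  then obtain y where "y \<in> Y" "\<bar>v\<bar> \<le> \<bar>y\<bar>"
    using XY v unfolding sgn_dominated_def by blast
  then have "v \<in> Y" using top by auto
  then show ?thesis
    using top unfolding abs_dominant_def by (meson not_less)
qed

text \<open>If either maximum is nonzero, it is dominant in its own set and hence in the other;
  otherwise both are 0.\<close>

lemma bipolar_max_cong_dominated:
  assumes "sgn_dominated X Y" "sgn_dominated Y X"
  shows "bipolar_max X = bipolar_max Y"
  using assms abs_dominant_transfer bipolar_max_eq bipolar_max_nonzeroD by metis

section \<open>Sugeno terms and level sets\<close>

definition sugeno_term :: "real \<Rightarrow> real \<Rightarrow> real"
  where "sugeno_term m l = sgn m * min \<bar>m\<bar> l"

lemma abs_sugeno_term: "0 \<le> l \<Longrightarrow> \<bar>sugeno_term m l\<bar> = min \<bar>m\<bar> l"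
  by (auto simp: sugeno_term_def abs_mult sgn_if)

lemma sgn_sugeno_term: "0 < l \<Longrightarrow> sgn (sugeno_term m l) = sgn m"
  by (auto simp: sugeno_term_def sgn_mult sgn_if)

text \<open>The two sets of terms dominate each other. A nonzero component has its level among the
  \<open>l i\<close> and yields the same term; conversely, \<open>l i\<close> can be raised to the
  next attained level without changing the pair, which keeps the sign of the term and does not
  shrink it.\<close>

lemma bipolar_sugeno_levels:
  fixes x :: "real ^ 'n"
  assumes l: "\<And>i. i \<in> I \<Longrightarrow> 0 < l i"
    and P: "\<And>i. i \<in> I \<Longrightarrow> P i = ({j. l i \<le> x $ j}, {j. x $ j \<le> - l i})"
    and x: "\<And>j. x $ j \<noteq> 0 \<Longrightarrow> \<bar>x $ j\<bar> \<in> l ` I"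
    and \<mu>: "\<mu> ({}, {}) = 0"
  shows "bipolar_sugeno x \<mu> = bipolar_max ((\<lambda>i. sugeno_term (\<mu> (P i)) (l i)) ` I)"
proof -
  let ?X = "range (\<lambda>j. sugeno_term (\<mu> (level_pair x j)) \<bar>x $ j\<bar>)"
  let ?Y = "(\<lambda>i. sugeno_term (\<mu> (P i)) (l i)) ` I"
  have XY: "sgn_dominated ?X ?Y"
    unfolding sgn_dominated_def
  proof (intro ballI impI)
    fix t assume "t \<in> ?X" "t \<noteq> 0"
    then obtain j where j: "t = sugeno_term (\<mu> (level_pair x j)) \<bar>x $ j\<bar>" by blast
    \<comment> \<open>Zero components contribute the term 0, so the special case in
      \<open>level_pair\<close> never matters here.\<close>
    have nz: "x $ j \<noteq> 0" using \<open>t \<noteq> 0\<close> j by (auto simp: sugeno_term_def)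
    then obtain i where i: "i \<in> I" "\<bar>x $ j\<bar> = l i" using x by blast
    then have "level_pair x j = P i"
      using nz P by (simp add: level_pair_def)
    then have "t \<in> ?Y" using i j by auto
    then show "\<exists>y\<in>?Y. sgn t = sgn y \<and> \<bar>t\<bar> \<le> \<bar>y\<bar>" by blast
  qed
  have YX: "sgn_dominated ?Y ?X"
    unfolding sgn_dominated_def
  proof (intro ballI impI)
    fix t assume "t \<in> ?Y" "t \<noteq> 0"
    then obtain i where i: "i \<in> I" and t: "t = sugeno_term (\<mu> (P i)) (l i)" by blast
    have "\<mu> (P i) \<noteq> 0" using \<open>t \<noteq> 0\<close> t by (auto simp: sugeno_term_def)
    \<comment> \<open>As \<mu> vanishes at the empty pair, some component of \<open>x\<close>
      reaches the level \<open>l i\<close>.\<close>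
    then have "P i \<noteq> ({}, {})" using \<mu> by metis
    then have ne: "{j. l i \<le> \<bar>x $ j\<bar>} \<noteq> {}"
      using P[OF i] l[OF i] by auto (metis abs_ge_self abs_ge_minus_self order_trans le_minus_iff)+
    \<comment> \<open>The least attained level from \<open>l i\<close> upwards: no component has
      absolute value in between, so both levels cut out the same pair.\<close>
    define j where "j = arg_min_on (\<lambda>j. \<bar>x $ j\<bar>) {j. l i \<le> \<bar>x $ j\<bar>}"
    have lj: "l i \<le> \<bar>x $ j\<bar>"
      using arg_min_if_finite(1)[OF _ ne, of "\<lambda>j. \<bar>x $ j\<bar>"] unfolding j_def by simp
    have min: "\<bar>x $ j\<bar> \<le> \<bar>x $ j'\<bar>" if "l i \<le> \<bar>x $ j'\<bar>" for j'
      unfolding j_def using that ne by (intro arg_min_least) auto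
    have "x $ j \<noteq> 0" using lj l[OF i] by auto
    have "level_pair x j = P i"
    proof -
      have "\<bar>x $ j\<bar> \<le> x $ j' \<longleftrightarrow> l i \<le> x $ j'" for j'
        using lj l[OF i] min[of j'] by linarith
      moreover have "x $ j' \<le> - \<bar>x $ j\<bar> \<longleftrightarrow> x $ j' \<le> - l i" for j'
        using lj l[OF i] min[of j'] by linarith
      ultimately show ?thesis
        using \<open>x $ j \<noteq> 0\<close> P[OF i] by (simp add: level_pair_def)
    qed
    then have "sgn t = sgn (sugeno_term (\<mu> (level_pair x j)) \<bar>x $ j\<bar>)"
        "\<bar>t\<bar> \<le> \<bar>sugeno_term (\<mu> (level_pair x j)) \<bar>x $ j\<bar>\<bar>"
      using t lj l[OF i] \<open>x $ j \<noteq> 0\<close> by (auto simp: sgn_sugeno_term abs_sugeno_term)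
    then show "\<exists>y\<in>?X. sgn t = sgn y \<and> \<bar>t\<bar> \<le> \<bar>y\<bar>" by blast
  qed
  have "bipolar_sugeno x \<mu> = bipolar_max ?X"
    by (simp add: bipolar_sugeno_def sugeno_term_def)
  then show ?thesis using bipolar_max_cong_dominated[OF XY YX] by simp
qed

lemma bipolar_sugeno_bi_indicator:
  assumes "0 < r" "P \<in> Q" "\<mu> ({}, {}) = 0"
  shows "bipolar_sugeno (r *\<^sub>R bi_indicator P) \<mu> = sugeno_term (\<mu> P) r"
proof -
  \<comment> \<open>A family with the single level \<open>r\<close>, indexed by the unit
    type.\<close>
  have "bipolar_sugeno (r *\<^sub>R bi_indicator P) \<mu> =
      bipolar_max ((\<lambda>i. sugeno_term (\<mu> P) r) ` {()})"
    using assms by (intro bipolar_sugeno_levels)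
      (auto simp: bi_indicator_def Q_def prod_eq_iff split: if_splits)
  then show ?thesis by simp
qed

section \<open>Nested families of scaled indicators\<close>

lemma pair_subset_chain:
  fixes P :: "nat \<Rightarrow> 'n set \<times> 'n set"
  assumes "\<And>i. i \<in> {1..<k} \<Longrightarrow> pair_subset (P (i + 1)) (P i)"
    and "1 \<le> i" "i \<le> m" "m \<le> k"
  shows "pair_subset (P m) (P i)"
  using assms(3,4)
proof (induction m rule: dec_induct)
  case base
  then show ?case by (simp add: pair_subset_def)
next
  case (step m)
  then have "pair_subset (P (m + 1)) (P m)" "pair_subset (P m) (P i)"
    using assms by auto
  then show ?case by (auto simp: pair_subset_def)
qed

text \<open>Pairs shrink while levels grow, so the nonzero contributions to component
  \<open>j\<close> all have one sign and the last of them is the largest. Thus \<bar>x_j\<bar> is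
  the last level whose pair contains \<open>j\<close>, and the level sets of \<open>x\<close> return
  the pairs.\<close>

lemma bipolar_max_vec_levels:
  fixes P :: "nat \<Rightarrow> 'n::finite set \<times> 'n set"
  assumes l: "\<And>i. i \<in> {1..k} \<Longrightarrow> 0 < l i"
    and mono: "strict_mono_on {1..k} l"
    and PQ: "\<And>i. i \<in> {1..k} \<Longrightarrow> P i \<in> Q"
    and chain: "\<And>i. i \<in> {1..<k} \<Longrightarrow> pair_subset (P (i + 1)) (P i)"
    and k: "1 \<le> k"
    and x: "x = bipolar_max_vec ((\<lambda>i. l i *\<^sub>R bi_indicator (P i)) ` {1..k})"
  shows "i \<in> {1..k} \<Longrightarrow> P i = ({j. l i \<le> x $ j}, {j. x $ j \<le> - l i})"
    and "x $ j \<noteq> 0 \<Longrightarrow> \<bar>x $ j\<bar> \<in> l ` {1..k}"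
proof -
  have xj: "x $ j = bipolar_max ((\<lambda>i. l i * bi_indicator (P i) $ j) ` {1..k})" for j
    by (simp add: x bipolar_max_vec_def image_image)
  have le: "l i \<le> l m \<longleftrightarrow> i \<le> m" if "i \<in> {1..k}" "m \<in> {1..k}" for i m
    using strict_mono_on_leD[OF mono] strict_mono_onD[OF mono] that
    by (meson linorder_not_less)
  \<comment> \<open>\<open>M j\<close> is the last index whose pair contains \<open>j\<close>; it is
    meaningful only for nonempty \<open>U j\<close>, hence the guard on the facts below.\<close>
  define U where "U j = {i \<in> {1..k}. j \<in> fst (P i) \<union> snd (P i)}" for j
  define M where "M j = Max (U j)" for j
  have M: "M j \<in> {1..k}" "j \<in> fst (P (M j)) \<union> snd (P (M j))"
    and le_M: "\<And>i. i \<in> {1..k} \<Longrightarrow> j \<in> fst (P i) \<union> snd (P i) \<Longrightarrow> i \<le> M j"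
    if "U j \<noteq> {}" for j
  proof -
    have fin: "finite (U j)" by (simp add: U_def)
    have "M j \<in> U j" unfolding M_def using fin that by (rule Max_in)
    then show "M j \<in> {1..k}" "j \<in> fst (P (M j)) \<union> snd (P (M j))" by (auto simp: U_def)
    fix i assume "i \<in> {1..k}" "j \<in> fst (P i) \<union> snd (P i)"
    then show "i \<le> M j" unfolding M_def using fin by (intro Max_ge) (auto simp: U_def)
  qed
  have sub: "fst (P m) \<subseteq> fst (P i)" "snd (P m) \<subseteq> snd (P i)"
    if "i \<in> {1..k}" "m \<in> {1..k}" "i \<le> m" for i m
    using pair_subset_chain[of k P i m] chain that by (auto simp: pair_subset_def)
  have disj: "fst (P i) \<inter> snd (P i) = {}" if "i \<in> {1..k}" for i
    using PQ[OF that] by (auto simp: Q_def)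
  \<comment> \<open>Because \<open>k\<close> is at least 1, the contributions form exactly the set
    {0}.\<close>
  have x0: "x $ j = 0" if "U j = {}" for j
  proof -
    have "(\<lambda>i. l i * bi_indicator (P i) $ j) ` {1..k} = {0}"
      using that k by (force simp: U_def bi_indicator_def)
    then show ?thesis by (simp add: xj)
  qed
  have xM: "x $ j = l (M j) * bi_indicator (P (M j)) $ j" if U: "U j \<noteq> {}" for j
  proof -
    have "bipolar_max ((\<lambda>i. l i * bi_indicator (P i) $ j) ` {1..k}) =
        bipolar_max {l (M j) * bi_indicator (P (M j)) $ j}"
    proof (rule bipolar_max_cong_dominated)
      have "sgn (l i * bi_indicator (P i) $ j) = sgn (l (M j) * bi_indicator (P (M j)) $ j) \<and>
          \<bar>l i * bi_indicator (P i) $ j\<bar> \<le> \<bar>l (M j) * bi_indicator (P (M j)) $ j\<bar>"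
        if i: "i \<in> {1..k}" and nz: "l i * bi_indicator (P i) $ j \<noteq> 0" for i
      proof -
        have "j \<in> fst (P i) \<union> snd (P i)" using nz by (auto simp: bi_indicator_def split: if_splits)
        then have iM: "i \<le> M j" using le_M U i by blast
        then have "bi_indicator (P i) $ j = bi_indicator (P (M j)) $ j"
          using sub[OF i M(1)[OF U]] M(2)[OF U] disj[OF i] by (auto simp: bi_indicator_def)
        moreover have "l i \<le> l (M j)" using iM le i M(1)[OF U] by blast
        ultimately show ?thesis
          using l[OF i] l[OF M(1)[OF U]] by (simp add: sgn_mult abs_mult mult_right_mono)
      qed
      then show "sgn_dominated ((\<lambda>i. l i * bi_indicator (P i) $ j) ` {1..k})
          {l (M j) * bi_indicator (P (M j)) $ j}"
        unfolding sgn_dominated_def by blast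
      show "sgn_dominated {l (M j) * bi_indicator (P (M j)) $ j}
          ((\<lambda>i. l i * bi_indicator (P i) $ j) ` {1..k})"
        unfolding sgn_dominated_def using M(1)[OF U] by blast
    qed
    then show ?thesis by (simp add: xj)
  qed
  show "P i = ({j. l i \<le> x $ j}, {j. x $ j \<le> - l i})" if i: "i \<in> {1..k}"
  proof -
    have "(j \<in> fst (P i) \<longleftrightarrow> l i \<le> x $ j) \<and> (j \<in> snd (P i) \<longleftrightarrow> x $ j \<le> - l i)" for j
    proof (cases "U j = {}")
      case True
      then show ?thesis using x0 l[OF i] i by (auto simp: U_def)
    next
      case U: False
      note M = M[OF U]
      have pos: "0 < l i" "0 < l (M j)" using l i M by auto
      \<comment> \<open>Membership of \<open>j\<close> in \<open>P i\<close> means that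
        \<open>i\<close> is at most \<open>M j\<close>; nesting and disjointness then force
        \<open>j\<close> onto the same side in \<open>P i\<close> as in
        \<open>P (M j)\<close>.\<close>
      have iff: "j \<in> fst (P i) \<union> snd (P i) \<longleftrightarrow> l i \<le> l (M j)"
        using le[OF i M(1)] le_M[OF U i] sub[OF i M(1)] M(2) by blast
      have eq: "j \<in> fst (P i) \<longleftrightarrow> j \<in> fst (P (M j))" if "l i \<le> l (M j)"
        using le[OF i M(1)] that sub[OF i M(1)] M(2) disj[OF i] disj[OF M(1)] by blast
      show ?thesis
      proof (cases "j \<in> fst (P (M j))")
        case True
        then have "x $ j = l (M j)" using xM[OF U] by (simp add: bi_indicator_def)
        then show ?thesis using True iff eq pos disj[OF i] by (smt (verit) Un_iff disjoint_iff)
      next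
        case False
        then have "x $ j = - l (M j)" using xM[OF U] M(2) by (simp add: bi_indicator_def)
        then show ?thesis using False iff eq pos disj[OF i] by (smt (verit) Un_iff disjoint_iff)
      qed
    qed
    then show ?thesis by (auto simp: prod_eq_iff)
  qed
  show "\<bar>x $ j\<bar> \<in> l ` {1..k}" if "x $ j \<noteq> 0"
  proof -
    have U: "U j \<noteq> {}" using x0 that by blast
    then have "\<bar>x $ j\<bar> = l (M j)"
      using xM[OF U] M[OF U] l[OF M(1)[OF U]] by (auto simp: bi_indicator_def)
    then show ?thesis using M(1)[OF U] by blast
  qed
qed

text \<open>The nested pairs are the level sets of the vector they build, so the formula over levels
  applies. Both directions of the equivalence rest on this.\<close>

lemma bipolar_sugeno_bipolar_max_vec:
  fixes P :: "nat \<Rightarrow> 'n::finite set \<times> 'n set"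
  assumes "\<And>i. i \<in> {1..k} \<Longrightarrow> 0 < l i" "strict_mono_on {1..k} l"
    and "\<And>i. i \<in> {1..k} \<Longrightarrow> P i \<in> Q"
    and "\<And>i. i \<in> {1..<k} \<Longrightarrow> pair_subset (P (i + 1)) (P i)"
    and "1 \<le> k" "\<mu> ({}, {}) = 0"
  shows "bipolar_sugeno (bipolar_max_vec ((\<lambda>i. l i *\<^sub>R bi_indicator (P i)) ` {1..k})) \<mu> =
    bipolar_max ((\<lambda>i. sugeno_term (\<mu> (P i)) (l i)) ` {1..k})"
  using bipolar_max_vec_levels[of k l P, OF assms(1-5)] assms
  by (intro bipolar_sugeno_levels) blast+

text \<open>A layer decomposition: component \<open>j\<close> receives its sign times
  \<open>l i\<close> from every level up to \<bar>x_j\<bar>, and the top one of these restores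
  x_j.\<close>

lemma bipolar_max_vec_decomposition:
  fixes x :: "real ^ 'n"
  assumes "x \<in> cube" "x \<noteq> 0"
  obtains k l and P :: "nat \<Rightarrow> 'n set \<times> 'n set"
  where "1 \<le> k" "\<And>i. i \<in> {1..k} \<Longrightarrow> 0 < l i \<and> l i \<le> 1" "strict_mono_on {1..k} l"
    and "\<And>i. i \<in> {1..k} \<Longrightarrow> P i \<in> Q"
    and "\<And>i. i \<in> {1..<k} \<Longrightarrow> pair_subset (P (i + 1)) (P i)"
    and "x = bipolar_max_vec ((\<lambda>i. l i *\<^sub>R bi_indicator (P i)) ` {1..k})"
proof -
  define S where "S = (\<lambda>j. \<bar>x $ j\<bar>) ` {j. x $ j \<noteq> 0}"
  have fin: "finite S" by (simp add: S_def)
  \<comment> \<open>Levels count from 1, list positions from 0. The list has no repetitions, so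
    \<open>l\<close> is strictly increasing.\<close>
  define l where "l i = sorted_list_of_set S ! (i - 1)" for i
  have len: "length (sorted_list_of_set S) = card S" by simp
  have mono: "strict_mono_on {1..card S} l"
    unfolding l_def by (intro strict_mono_onI sorted_wrt_nth_less[OF strict_sorted_list_of_set]) auto
  have "l ` {1..card S} = (!) (sorted_list_of_set S) ` {0..<card S}"
    by (simp add: l_def image_image image_Suc_atLeastLessThan[symmetric]
        atLeastLessThanSuc_atLeastAtMost[symmetric] del: image_Suc_atLeastLessThan)
  then have img: "l ` {1..card S} = S"
    using fin len by (simp add: nth_image)
  define P where "P i = ({j. l i \<le> x $ j}, {j. x $ j \<le> - l i})" for i :: nat
  have l: "0 < l i \<and> l i \<le> 1" if "i \<in> {1..card S}" for i
  proof -
    have "l i \<in> S" using that img by blast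
    then obtain j where "l i = \<bar>x $ j\<bar>" "x $ j \<noteq> 0" by (auto simp: S_def)
    moreover have "x $ j \<in> {-1..1}" using assms by (simp add: cube_def)
    ultimately show ?thesis by auto
  qed
  \<comment> \<open>The assumption that \<open>x\<close> is nonzero provides at least one
    level.\<close>
  have "\<exists>j. x $ j \<noteq> 0" using assms by (simp add: vec_eq_iff)
  then have k: "1 \<le> card S" using fin by (auto simp: S_def card_gt_0_iff Suc_le_eq)
  have PQ: "P i \<in> Q" if "i \<in> {1..card S}" for i
    using l[OF that] by (auto simp: P_def Q_def)
  have chain: "pair_subset (P (i + 1)) (P i)" if "i \<in> {1..<card S}" for i
    using strict_mono_onD[OF mono, of i "i + 1"] that by (auto simp: pair_subset_def P_def)
  have "x $ j = bipolar_max ((\<lambda>i. l i * bi_indicator (P i) $ j) ` {1..card S})" for j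
  proof -
    have val: "l i * bi_indicator (P i) $ j =
        (if l i \<le> \<bar>x $ j\<bar> then l i * sgn (x $ j) else 0)" if "i \<in> {1..card S}" for i
      using l[OF that] by (auto simp: bi_indicator_def P_def sgn_if)
    have "bipolar_max {x $ j} = bipolar_max ((\<lambda>i. l i * bi_indicator (P i) $ j) ` {1..card S})"
    proof (rule bipolar_max_cong_dominated)
      show "sgn_dominated {x $ j} ((\<lambda>i. l i * bi_indicator (P i) $ j) ` {1..card S})"
        unfolding sgn_dominated_def
      proof (intro ballI impI)
        fix v assume "v \<in> {x $ j}" "v \<noteq> 0"
        then have v: "v = x $ j" "x $ j \<noteq> 0" by auto
        then have "\<bar>x $ j\<bar> \<in> l ` {1..card S}" unfolding img by (auto simp: S_def)
        then obtain i where i: "i \<in> {1..card S}" "l i = \<bar>x $ j\<bar>" by auto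
        then have "l i * bi_indicator (P i) $ j = v"
          using val[OF i(1)] v by (simp add: abs_mult_sgn)
        then show "\<exists>y\<in>(\<lambda>i. l i * bi_indicator (P i) $ j) ` {1..card S}. sgn v = sgn y \<and> \<bar>v\<bar> \<le> \<bar>y\<bar>"
          using i by blast
      qed
      show "sgn_dominated ((\<lambda>i. l i * bi_indicator (P i) $ j) ` {1..card S}) {x $ j}"
        unfolding sgn_dominated_def
      proof (intro ballI impI)
        fix v assume "v \<in> (\<lambda>i. l i * bi_indicator (P i) $ j) ` {1..card S}" and "v \<noteq> 0"
        then obtain i where i: "i \<in> {1..card S}" and v: "v = l i * bi_indicator (P i) $ j" by blast
        then have "v = l i * sgn (x $ j)" "l i \<le> \<bar>x $ j\<bar>"
          using val[OF i] \<open>v \<noteq> 0\<close> by (auto split: if_splits)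
        then show "\<exists>y\<in>{x $ j}. sgn v = sgn y \<and> \<bar>v\<bar> \<le> \<bar>y\<bar>"
          using l[OF i] by (auto simp: sgn_mult abs_mult sgn_if)
      qed
    qed
    then show ?thesis by simp
  qed
  then have "x = bipolar_max_vec ((\<lambda>i. l i *\<^sub>R bi_indicator (P i)) ` {1..card S})"
    by (simp add: vec_eq_iff bipolar_max_vec_def image_image)
  then show ?thesis
    using that[of "card S" l P] k l mono PQ chain by blast
qed

section \<open>Values on indicators: from G to a bi-capacity and back\<close>

lemma bi_capacity_bi_indicator:
  fixes G :: "real ^ 'n \<Rightarrow> real"
  assumes G: "aggregation_function G" and "G 0 = 0"
  shows "bi_capacity (\<lambda>P. G (bi_indicator P))"
proof -
  \<comment> \<open>The extreme pairs become constant vectors, so the boundary values come from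
    those of \<open>G\<close> together with \<open>G 0 = 0\<close>.\<close>
  have ind: "bi_indicator ({}, {}) = (0 :: real ^ 'n)" "bi_indicator (UNIV, {}) = (vec 1 :: real ^ 'n)"
    "bi_indicator ({}, UNIV) = (vec (-1) :: real ^ 'n)"
    by (simp_all add: bi_indicator_def vec_eq_iff)
  have cube: "(bi_indicator P :: real ^ 'n) \<in> cube" for P
    by (simp add: bi_indicator_def cube_def)
  have mono: "(bi_indicator P :: real ^ 'n) $ i \<le> bi_indicator R $ i"
    if "P \<in> Q" "R \<in> Q" "pair_prec P R" for P R :: "'n set \<times> 'n set" and i
    using that by (auto simp: bi_indicator_def pair_prec_def Q_def)
  show ?thesis
    using G \<open>G 0 = 0\<close> mono cube unfolding bi_capacity_def aggregation_function_def
    by (auto simp: ind Pi_iff)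
qed

text \<open>Both stability properties are applied to the levels \<open>r\<close> and 1. The first
  fixes the sign; the second leaves the size equal to that at level 1 or to \<open>r\<close>, and
  the bound by \<open>r\<close> selects the minimum.\<close>

lemma bi_indicator_sugeno_term:
  fixes G :: "real ^ 'n \<Rightarrow> real"
  assumes G: "aggregation_function G" "idempotent G" "bipolar_stable_sign G" "bipolar_stable_min G"
    and r: "0 < r" "r \<le> 1" and P: "P \<in> Q"
  shows "G (r *\<^sub>R bi_indicator P) = sugeno_term (G (bi_indicator P)) r"
proof -
  let ?g = "G (r *\<^sub>R bi_indicator P)" and ?m = "G (bi_indicator P)"
  have in_cube: "vec (-r) \<in> (cube :: (real ^ 'n) set)" "vec r \<in> (cube :: (real ^ 'n) set)"
    "r *\<^sub>R bi_indicator P \<in> (cube :: (real ^ 'n) set)" "bi_indicator P \<in> (cube :: (real ^ 'n) set)"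
    using r by (auto simp: cube_def bi_indicator_def)
  have "G (vec (-r)) \<le> ?g" "?g \<le> G (vec r)"
    using G(1) in_cube r unfolding aggregation_function_def by (auto simp: bi_indicator_def)
  moreover have "G (vec (-r)) = -r" "G (vec r) = r"
    using G(2) r by (auto simp: idempotent_def)
  ultimately have g_le: "\<bar>?g\<bar> \<le> r" by linarith
  have m_le: "\<bar>?m\<bar> \<le> 1"
    using G(1) in_cube(4) unfolding aggregation_function_def by (auto simp: Pi_iff abs_le_iff)
  have "?g * ?m > 0 \<or> (?g = 0 \<and> ?m = 0)"
    using G(3) r P unfolding bipolar_stable_sign_def
    by (metis greaterThanAtMost_iff order_refl scaleR_one zero_less_one)
  then have sgn: "sgn ?g = sgn ?m"
    by (auto simp: sgn_if zero_less_mult_iff)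
  have "\<bar>?g\<bar> = min \<bar>?m\<bar> r"
  \<comment> \<open>Stability for the minimum compares distinct levels only; at level 1 the claim is
    the range bound on \<open>G\<close>.\<close>
  proof (cases "r = 1")
    case True
    then show ?thesis using m_le by simp
  next
    case False
    then have "\<bar>?m\<bar> \<ge> \<bar>?g\<bar> \<and> (\<bar>?m\<bar> > \<bar>?g\<bar> \<longrightarrow> \<bar>?g\<bar> = r)"
      using G(4) r P unfolding bipolar_stable_min_def
      by (metis greaterThanAtMost_iff order_le_less scaleR_one zero_less_one)
    then show ?thesis using g_le by linarith
  qed
  then show ?thesis
    unfolding sugeno_term_def using sgn by (metis mult.commute abs_mult_sgn)
qed

text \<open>For nonzero \<open>a\<close> every level pair is an extreme pair, where \<mu> is 1 or -1
  with the sign of \<open>a\<close>; for \<open>a = 0\<close> the minimum is 0. The maximum is thus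
  over a singleton.\<close>

lemma bipolar_sugeno_vec:
  assumes "bi_capacity \<mu>" "a \<in> {-1..1}"
  shows "bipolar_sugeno (vec a) \<mu> = a"
proof -
  have "sgn (\<mu> (level_pair (vec a) i)) * min \<bar>\<mu> (level_pair (vec a) i)\<bar> \<bar>a\<bar> = a" for i :: 'a
    using assms by (cases "a = 0"; cases "0 < a")
      (auto simp: level_pair_def bi_capacity_def)
  then show ?thesis by (simp add: bipolar_sugeno_def)
qed

text \<open>The sign of a term is that of \<open>\<mu> P\<close> at every positive level. Its size
  can grow beyond level \<open>s\<close> only if \<open>s\<close> is below the absolute value of
  \<open>\<mu> P\<close>, and then the size at \<open>s\<close> is \<open>s\<close>.\<close>

lemma stable_of_sugeno_term:
  fixes G :: "real ^ 'n \<Rightarrow> real"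
  assumes "\<And>r P. r \<in> {0<..1} \<Longrightarrow> P \<in> Q \<Longrightarrow> G (r *\<^sub>R bi_indicator P) = sugeno_term (\<mu> P) r"
  shows "bipolar_stable_sign G" "bipolar_stable_min G"
proof -
  have "0 < sugeno_term m r * sugeno_term m s \<or> (sugeno_term m r = 0 \<and> sugeno_term m s = 0)"
    if "0 < r" "0 < s" for m r s
    using that by (auto simp: sugeno_term_def sgn_if)
  then show "bipolar_stable_sign G"
    unfolding bipolar_stable_sign_def using assms by simp
  show "bipolar_stable_min G"
    unfolding bipolar_stable_min_def using assms by (auto simp: abs_sugeno_term)
qed

section \<open>Characterization of the bipolar Sugeno integral\<close>

theorem theorem8:
  fixes G :: "real ^ 'n \<Rightarrow> real"
  assumes "aggregation_function G"
  shows "(idempotent G \<and> bipolar_comonotone_maxitive G \<and>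
          bipolar_stable_sign G \<and> bipolar_stable_min G) \<longleftrightarrow>
         (\<exists>\<mu>. bi_capacity \<mu> \<and> (\<forall>x\<in>cube. G x = bipolar_sugeno x \<mu>))"
proof
  assume L: "idempotent G \<and> bipolar_comonotone_maxitive G \<and>
          bipolar_stable_sign G \<and> bipolar_stable_min G"
  \<comment> \<open>On \<open>Q\<close> this choice is forced: the integral of the indicator of
    \<open>P\<close> is \<open>\<mu> P\<close>.\<close>
  define \<mu> where "\<mu> = (\<lambda>P. G (bi_indicator P))"
  have "vec 0 = (0 :: real ^ 'n)" by (simp add: vec_eq_iff)
  then have G0: "G 0 = 0"
    using L unfolding idempotent_def by (metis atLeastAtMost_iff neg_le_0_iff_le zero_le_one)
  then have \<mu>: "bi_capacity \<mu>"
    unfolding \<mu>_def using assms by (intro bi_capacity_bi_indicator)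
  then have \<mu>0: "\<mu> ({}, {}) = 0" by (simp add: bi_capacity_def)
  have "G x = bipolar_sugeno x \<mu>" if x: "x \<in> cube" for x
  \<comment> \<open>The zero vector has no positive level to decompose along; both sides are 0
    there.\<close>
  proof (cases "x = 0")
    case True
    then show ?thesis using G0 by (simp add: bipolar_sugeno_def)
  next
    case False
    obtain k l and P :: "nat \<Rightarrow> 'n set \<times> 'n set"
      where k: "1 \<le> k" and l: "\<And>i. i \<in> {1..k} \<Longrightarrow> 0 < l i \<and> l i \<le> 1"
        and mono: "strict_mono_on {1..k} l"
        and PQ: "\<And>i. i \<in> {1..k} \<Longrightarrow> P i \<in> Q"
        and chain: "\<And>i. i \<in> {1..<k} \<Longrightarrow> pair_subset (P (i + 1)) (P i)"
        and dec: "x = bipolar_max_vec ((\<lambda>i. l i *\<^sub>R bi_indicator (P i)) ` {1..k})"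
      using bipolar_max_vec_decomposition[OF x False] by blast
    have "G x = bipolar_max ((\<lambda>i. G (l i *\<^sub>R bi_indicator (P i))) ` {1..k})"
      unfolding dec using L k l mono PQ chain unfolding bipolar_comonotone_maxitive_def by blast
    also have "(\<lambda>i. G (l i *\<^sub>R bi_indicator (P i))) ` {1..k} =
        (\<lambda>i. sugeno_term (\<mu> (P i)) (l i)) ` {1..k}"
      unfolding \<mu>_def using assms L l PQ by (intro image_cong refl bi_indicator_sugeno_term) auto
    also have "bipolar_max \<dots> = bipolar_sugeno x \<mu>"
      unfolding dec using l mono PQ chain k \<mu>0
      by (intro bipolar_sugeno_bipolar_max_vec[symmetric]) auto
    finally show ?thesis .
  qed
  then show "\<exists>\<mu>. bi_capacity \<mu> \<and> (\<forall>x\<in>cube. G x = bipolar_sugeno x \<mu>)"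
    using \<mu> by blast
next
  assume "\<exists>\<mu>. bi_capacity \<mu> \<and> (\<forall>x\<in>cube. G x = bipolar_sugeno x \<mu>)"
  then obtain \<mu> where \<mu>: "bi_capacity \<mu>" and G: "\<And>x. x \<in> cube \<Longrightarrow> G x = bipolar_sugeno x \<mu>"
    by blast
  have \<mu>0: "\<mu> ({}, {}) = 0" using \<mu> by (simp add: bi_capacity_def)
  have G_ind: "G (r *\<^sub>R bi_indicator P) = sugeno_term (\<mu> P) r" if "r \<in> {0<..1}" "P \<in> Q" for r P
  proof -
    have "r *\<^sub>R bi_indicator P \<in> (cube :: (real ^ 'n) set)"
      using that by (auto simp: cube_def bi_indicator_def)
    then show ?thesis using G bipolar_sugeno_bi_indicator[of r P \<mu>] that \<mu>0 by simp
  qed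
  have "idempotent G"
    unfolding idempotent_def using \<mu> G by (auto simp: bipolar_sugeno_vec cube_def)
  moreover have "bipolar_comonotone_maxitive G"
    unfolding bipolar_comonotone_maxitive_def
  proof (intro allI impI, elim conjE)
    fix k :: nat and l :: "nat \<Rightarrow> real" and P :: "nat \<Rightarrow> 'n set \<times> 'n set"
    let ?x = "bipolar_max_vec ((\<lambda>i. l i *\<^sub>R bi_indicator (P i)) ` {1..k})"
    assume k: "1 \<le> k" and l: "\<forall>i\<in>{1..k}. 0 < l i \<and> l i \<le> 1"
      and mono: "strict_mono_on {1..k} l" and PQ: "\<forall>i\<in>{1..k}. P i \<in> Q"
      and chain: "\<forall>i\<in>{1..<k}. pair_subset (P (i + 1)) (P i)"
    \<comment> \<open>\<open>G\<close> is known to agree with the integral only on the cube; nonzero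
      components of the maximum are levels up to sign, hence bounded by 1.\<close>
    have "?x $ j \<in> {-1..1}" for j
    proof (cases "?x $ j = 0")
      case False
      then have "\<bar>?x $ j\<bar> \<in> l ` {1..k}"
        using l mono PQ chain k by (intro bipolar_max_vec_levels(2)[of k l P]) auto
      then have "\<bar>?x $ j\<bar> \<le> 1" using l by auto
      then show ?thesis by auto
    qed simp
    then have "G ?x = bipolar_sugeno ?x \<mu>"
      by (intro G) (simp add: cube_def)
    also have "\<dots> = bipolar_max ((\<lambda>i. sugeno_term (\<mu> (P i)) (l i)) ` {1..k})"
      using l mono PQ chain k \<mu>0 by (intro bipolar_sugeno_bipolar_max_vec) auto
    also have "(\<lambda>i. sugeno_term (\<mu> (P i)) (l i)) ` {1..k} =
        (\<lambda>i. G (l i *\<^sub>R bi_indicator (P i))) ` {1..k}"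
      using l PQ by (intro image_cong refl G_ind[symmetric]) auto
    finally show "G ?x = bipolar_max ((\<lambda>i. G (l i *\<^sub>R bi_indicator (P i))) ` {1..k})" .
  qed
  moreover have "bipolar_stable_sign G" "bipolar_stable_min G"
    using stable_of_sugeno_term[of G \<mu>] G_ind by blast+
  ultimately show "idempotent G \<and> bipolar_comonotone_maxitive G \<and>
          bipolar_stable_sign G \<and> bipolar_stable_min G"
    by blast
qed

end
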